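(* Let $h>1$ and $m\ge1$ be integers, and let $\lambda\in[0,1]$. In any $\gamma$-discounted MDP, let $v$ be a value function and $\pi_h\in\mathcal{G}_h(v)$ be such that $(v,\pi_h)$ is $h$-greedy consistent. Then $$\|v^*-(T^{\pi_h})^mv\|_\infty\le(\gamma^m+\gamma^h)\,\|v^*-v\|_\infty,\qquad(\mathrm{i})$$ $$\|v^*-T^{\pi_h}_\lambda v\|_\infty\le\left(\frac{\gamma(1-\lambda)}{1-\lambda\gamma}+\gamma^h\right)\|v^*-v\|_\infty.\qquad(\mathrm{ii})$$ Additionally, there exist a $\gamma$-discounted MDP, a value function $v$, and a policy $\pi_h\in\mathcal{G}_h(v)$ such that $(v,\pi_h)$ is $h$-greedy consistent, for which (i) and (ii) hold with equality.
   Context: Setting: an infinite-horizon discounted Markov decision process (a "$\gamma$-discounted MDP") $(\mathcal{S},\mathcal{A},P,R,\gamma)$ with finite state space $\mathcal{S}$, finite action space $\mathcal{A}$, transition kernel $P(s'\mid s,a)$, reward function $r(s,a)\in[R_{\min},R_{\max}]$ and discount factor $\gamma\in(0,1)$. A policy is a stationary map $\pi:\mathcal{S}\to\mathcal{P}(\mathcal{A})$ into probability distributions on $\mathcal{A}$. Let $[P^\pi]_{s,s'}=P(s'\mid s,\pi(s))$ and $[r^\pi]_s=r(s,\pi(s))$ (averaged over the action distribution $\pi(s)$). The value of $\pi$ is $v^\pi=(I-\gamma P^\pi)^{-1}r^\pi$, and the optimal value is $v^*=\max_\pi v^\pi$ (component-wise). A value function is a vector $v\in\mathbb{R}^{|\mathcal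 S|}$; inequalities between vectors are component-wise. Bellman operators: $T^\pi v=r^\pi+\gamma P^\pi v$ and $Tv=\max_\pi T^\pi v$ (component-wise); $T^{j}$ is the $j$-fold iterate, with $T^0$ the identity. $\lambda$-return operator: for $\lambda\in[0,1]$, $T^\pi_\lambda v=v+(I-\gamma\lambda P^\pi)^{-1}(T^\pi v-v)$, which for $\lambda<1$ equals $(1-\lambda)\sum_{j=0}^\infty\lambda^j(T^\pi)^{j+1}v$. $h$-greedy policies: $\mathcal{G}_h(v)=\{\pi: T^\pi T^{h-1}v=T^hv\}$. $h$-greedy consistency: a pair $(v,\pi)$ is $h$-greedy consistent if $T^\pi T^{h-1}v\ge T^{h-1}v$. *)

theory Defs
  imports "HOL-Probability.Probability_Mass_Function"
begin

record ('s, 'a) mdp =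
  states :: "'s set"
  actions :: "'a set"
  kernel :: "'s \<Rightarrow> 'a \<Rightarrow> 's pmf"
  reward :: "'s \<Rightarrow> 'a \<Rightarrow> real"
  discount :: real

(* Since states and actions are finite sets, the rewards automatically lie in some
   interval [Rmin, Rmax]. *)
definition finite_mdp :: "('s, 'a) mdp \<Rightarrow> bool" where
  "finite_mdp M \<longleftrightarrow>
     finite (states M) \<and> states M \<noteq> {} \<and>
     finite (actions M) \<and> actions M \<noteq> {} \<and>
     (\<forall>s\<in>states M. \<forall>a\<in>actions M. set_pmf (kernel M s a) \<subseteq> states M) \<and>
     0 < discount M \<and> discount M < 1"

(* Vectors indexed by the states, represented as extensional functions (undefined
   outside the carrier), so that equality of functions is equality of vectors. *)
definition value_functions :: "('s, 'a) mdp \<Rightarrow> ('s \<Rightarrow> real) set" where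
  "value_functions M = states M \<rightarrow>\<^sub>E UNIV"

definition policies :: "('s, 'a) mdp \<Rightarrow> ('s \<Rightarrow> 'a pmf) set" where
  "policies M = {\<pi>. \<forall>s\<in>states M. set_pmf (\<pi> s) \<subseteq> actions M}"

definition policy_kernel :: "('s, 'a) mdp \<Rightarrow> ('s \<Rightarrow> 'a pmf) \<Rightarrow> 's \<Rightarrow> 's \<Rightarrow> real" where
  "policy_kernel M \<pi> s s' = (\<Sum>a\<in>actions M. pmf (\<pi> s) a * pmf (kernel M s a) s')"

definition policy_reward :: "('s, 'a) mdp \<Rightarrow> ('s \<Rightarrow> 'a pmf) \<Rightarrow> 's \<Rightarrow> real" where
  "policy_reward M \<pi> = (\<lambda>s\<in>states M. \<Sum>a\<in>actions M. pmf (\<pi> s) a * reward M s a)"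

definition apply_kernel ::
  "('s, 'a) mdp \<Rightarrow> ('s \<Rightarrow> 'a pmf) \<Rightarrow> ('s \<Rightarrow> real) \<Rightarrow> 's \<Rightarrow> real" where
  "apply_kernel M \<pi> v = (\<lambda>s\<in>states M. \<Sum>s'\<in>states M. policy_kernel M \<pi> s s' * v s')"

(* The inverse of I - c P^pi, as a linear map on the vectors indexed by the states.
   For a policy pi and 0 <= c < 1 the map I - c P^pi is a bijection of this space. *)
definition resolvent ::
  "('s, 'a) mdp \<Rightarrow> ('s \<Rightarrow> 'a pmf) \<Rightarrow> real \<Rightarrow> ('s \<Rightarrow> real) \<Rightarrow> 's \<Rightarrow> real" where
  "resolvent M \<pi> c =
     inv_into (value_functions M) (\<lambda>w. \<lambda>s\<in>states M. w s - c * apply_kernel M \<pi> w s)"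

definition policy_value :: "('s, 'a) mdp \<Rightarrow> ('s \<Rightarrow> 'a pmf) \<Rightarrow> 's \<Rightarrow> real" where
  "policy_value M \<pi> = resolvent M \<pi> (discount M) (policy_reward M \<pi>)"

(* Here and in bellman_opt the supremum over the stationary policies is a maximum. *)
definition opt_value :: "('s, 'a) mdp \<Rightarrow> 's \<Rightarrow> real" where
  "opt_value M = (\<lambda>s\<in>states M. SUP \<pi>\<in>policies M. policy_value M \<pi> s)"

definition bellman ::
  "('s, 'a) mdp \<Rightarrow> ('s \<Rightarrow> 'a pmf) \<Rightarrow> ('s \<Rightarrow> real) \<Rightarrow> 's \<Rightarrow> real" where
  "bellman M \<pi> v =
     (\<lambda>s\<in>states M. policy_reward M \<pi> s + discount M * apply_kernel M \<pi> v s)"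

definition bellman_opt :: "('s, 'a) mdp \<Rightarrow> ('s \<Rightarrow> real) \<Rightarrow> 's \<Rightarrow> real" where
  "bellman_opt M v = (\<lambda>s\<in>states M. SUP \<pi>\<in>policies M. bellman M \<pi> v s)"

definition lambda_return ::
  "('s, 'a) mdp \<Rightarrow> real \<Rightarrow> ('s \<Rightarrow> 'a pmf) \<Rightarrow> ('s \<Rightarrow> real) \<Rightarrow> 's \<Rightarrow> real" where
  "lambda_return M l \<pi> v =
     (\<lambda>s\<in>states M. v s +
        resolvent M \<pi> (discount M * l) (\<lambda>s'\<in>states M. bellman M \<pi> v s' - v s') s)"

definition greedy_policies ::
  "('s, 'a) mdp \<Rightarrow> nat \<Rightarrow> ('s \<Rightarrow> real) \<Rightarrow> ('s \<Rightarrow> 'a pmf) set" where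
  "greedy_policies M h v =
     {\<pi> \<in> policies M. bellman M \<pi> ((bellman_opt M ^^ (h - 1)) v) = (bellman_opt M ^^ h) v}"

definition greedy_consistent ::
  "('s, 'a) mdp \<Rightarrow> nat \<Rightarrow> ('s \<Rightarrow> real) \<Rightarrow> ('s \<Rightarrow> 'a pmf) \<Rightarrow> bool" where
  "greedy_consistent M h v \<pi> \<longleftrightarrow>
     (\<forall>s\<in>states M. bellman M \<pi> ((bellman_opt M ^^ (h - 1)) v) s
                      \<ge> (bellman_opt M ^^ (h - 1)) v s)"

definition sup_dist :: "('s, 'a) mdp \<Rightarrow> ('s \<Rightarrow> real) \<Rightarrow> ('s \<Rightarrow> real) \<Rightarrow> real" where
  "sup_dist M u v = Max ((\<lambda>s. \<bar>u s - v s\<bar>) ` states M)"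

end

theory Submission
  imports Defs
begin

text \<open>
  Write \<open>w = T\<^bsup>h-1\<^esup> v\<close> and \<open>D = \<parallel>v\<^sup>* - v\<parallel>\<close>. Consistency says \<open>w \<le> T\<^sup>\<pi> w\<close>, so the iterates of
  \<open>T\<^sup>\<pi>\<close> from \<open>w\<close> increase towards \<open>v\<^sup>\<pi>\<close>; hence \<open>w \<le> v\<^sup>\<pi> \<le> v\<^sup>*\<close> and
  \<open>(T\<^sup>\<pi>)\<^sup>m w \<ge> T\<^sup>\<pi> w = T\<^sup>h v \<ge> v\<^sup>* - \<gamma>\<^sup>h D\<close>. Since \<open>w - v \<le> v\<^sup>* - v \<le> D\<close>, passing from \<open>w\<close> to \<open>v\<close> costs
  only a further \<open>\<gamma>\<^sup>m D\<close>, and the reverse inequality \<open>(T\<^sup>\<pi>)\<^sup>m v \<le> v\<^sup>* + \<gamma>\<^sup>m D\<close> is immediate. The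
  \<open>\<lambda>\<close>-return is treated in the same way, as the fixed point of
  \<open>x \<mapsto> T\<^sup>\<pi> ((1 - \<lambda>) v + \<lambda> x)\<close>.

  For tightness, a start state may enter a loop with \<open>v = -1\<close> that has an exit to a state where
  \<open>v\<close> is exact, or collect \<open>\<gamma>\<^sup>h\<close> on the way to an absorbing state with \<open>v = -1\<close>. After \<open>h\<close> steps
  of lookahead both choices look alike, as do staying in the loop and leaving it; the policy that
  enters the loop and stays there suffers both error terms.
\<close>

section \<open>Fixed points of sup-norm contractions\<close>

text \<open>Banach's iteration, carried out componentwise: the increments of \<open>x n\<close> are
  dominated by a geometric series. Closeness is measured on \<open>S\<close> only, so values outside
  \<open>S\<close> cannot affect \<open>F u\<close> on \<open>S\<close>, and the limit may be
  restricted to \<open>S\<close>.\<close>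

lemma sup_contraction_fixpoint:
  fixes F :: "('s \<Rightarrow> real) \<Rightarrow> 's \<Rightarrow> real"
  assumes fin: "finite S" and c: "0 \<le> c" "c < 1"
    and contr: "\<And>u v D. (\<forall>s\<in>S. \<bar>u s - v s\<bar> \<le> D) \<Longrightarrow> (\<forall>s\<in>S. \<bar>F u s - F v s\<bar> \<le> c * D)"
  shows "\<exists>u\<in>S \<rightarrow>\<^sub>E UNIV. \<forall>s\<in>S. F u s = u s"
proof -
  define x where "x n = (F ^^ n) (\<lambda>_. 0)" for n
  have xS: "x (Suc n) = F (x n)" for n
    by (simp add: x_def)
  define C where "C = (\<Sum>s\<in>S. \<bar>x 1 s - x 0 s\<bar>)"
  have step: "\<forall>s\<in>S. \<bar>x (Suc n) s - x n s\<bar> \<le> c ^ n * C" for n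
  proof (induction n)
    case 0
    then show ?case
      using fin by (auto simp: C_def intro: member_le_sum[where f = "\<lambda>s. \<bar>x 1 s - x 0 s\<bar>", simplified])
  next
    case (Suc n)
    then show ?case
      using contr[of "x (Suc n)" "x n" "c ^ n * C"] by (simp add: xS mult.assoc)
  qed
  have "convergent (\<lambda>n. x n s)" if s: "s \<in> S" for s
  proof -
    have "summable (\<lambda>n. c ^ n * C)"
      using c by (intro summable_mult2 summable_geometric) auto
    then have "summable (\<lambda>n. x (Suc n) s - x n s)"
      by (rule summable_comparison_test'[of _ 0]) (use step s in simp)
    then have "(\<lambda>n. \<Sum>i<n. x (Suc i) s - x i s) \<longlonglongrightarrow> (\<Sum>i. x (Suc i) s - x i s)"
      by (rule summable_LIMSEQ)
    then have "(\<lambda>n. x n s - x 0 s) \<longlonglongrightarrow> (\<Sum>i. x (Suc i) s - x i s)"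
      by (simp only: sum_lessThan_telescope[of "\<lambda>n. x n s"])
    from tendsto_add[OF this tendsto_const[of "x 0 s"]] show ?thesis
      unfolding convergent_def by auto
  qed
  then obtain y where y: "\<And>s. s \<in> S \<Longrightarrow> (\<lambda>n. x n s) \<longlonglongrightarrow> y s"
    unfolding convergent_def by metis
  define u where "u = restrict y S"
  have lim: "(\<lambda>n. x n s) \<longlonglongrightarrow> u s" if "s \<in> S" for s
    using y that by (simp add: u_def)
  have "F u s = u s" if s: "s \<in> S" for s
  proof -
    \<comment> \<open>This finite sum dominates every component, and it tends to zero because the
      components do.\<close>
    define d where "d n = (\<Sum>t\<in>S. \<bar>x n t - u t\<bar>)" for n
    have "d \<longlonglongrightarrow> (\<Sum>t\<in>S. \<bar>u t - u t\<bar>)"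
      unfolding d_def by (intro tendsto_sum tendsto_rabs tendsto_diff lim tendsto_const)
    then have "(\<lambda>n. c * d n) \<longlonglongrightarrow> 0"
      by (intro tendsto_mult_right_zero) simp
    moreover have "\<bar>x (Suc n) s - F u s\<bar> \<le> c * d n" for n
    proof -
      have "\<forall>t\<in>S. \<bar>x n t - u t\<bar> \<le> d n"
        unfolding d_def using fin by (auto intro: member_le_sum[where f = "\<lambda>t. \<bar>x n t - u t\<bar>"])
      then show ?thesis
        using contr s by (simp add: xS)
    qed
    ultimately have "(\<lambda>n. x (Suc n) s - F u s) \<longlonglongrightarrow> 0"
      using Lim_null_comparison[OF always_eventually, of "\<lambda>n. x (Suc n) s - F u s" "\<lambda>n. c * d n"]
      by (simp only: real_norm_def) blast
    then have "(\<lambda>n. x (Suc n) s) \<longlonglongrightarrow> F u s"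
      by (simp add: LIM_zero_iff)
    moreover have "(\<lambda>n. x (Suc n) s) \<longlonglongrightarrow> u s"
      using lim[OF s] by (rule LIMSEQ_Suc)
    ultimately show ?thesis
      by (rule LIMSEQ_unique)
  qed
  moreover have "u \<in> S \<rightarrow>\<^sub>E UNIV"
    by (simp add: u_def)
  ultimately show ?thesis
    by blast
qed

section \<open>Finite MDPs: averaging and the maximum principle\<close>

locale mdp_model =
  fixes M :: "('s, 'a) mdp"
  assumes finite_mdp: "finite_mdp M"
begin

abbreviation "S \<equiv> states M"
abbreviation "A \<equiv> actions M"
abbreviation "\<gamma> \<equiv> discount M"
abbreviation "v_opt \<equiv> opt_value M"

lemma
  shows finite_states: "finite S" and states_ne: "S \<noteq> {}"
    and finite_actions: "finite A" and actions_ne: "A \<noteq> {}"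
    and discount_pos: "0 < \<gamma>" and discount_less_1: "\<gamma> < 1"
    and kernel_subset: "\<And>s a. s \<in> S \<Longrightarrow> a \<in> A \<Longrightarrow> set_pmf (kernel M s a) \<subseteq> S"
  using finite_mdp by (auto simp: finite_mdp_def)

lemma sum_policy: "\<pi> \<in> policies M \<Longrightarrow> s \<in> S \<Longrightarrow> (\<Sum>a\<in>A. pmf (\<pi> s) a) = 1"
  using finite_actions by (intro sum_pmf_eq_1) (auto simp: policies_def)

lemma sum_policy_kernel:
  assumes "\<pi> \<in> policies M" "s \<in> S"
  shows "(\<Sum>s'\<in>S. policy_kernel M \<pi> s s') = 1"
proof -
  have "(\<Sum>s'\<in>S. policy_kernel M \<pi> s s')
      = (\<Sum>a\<in>A. pmf (\<pi> s) a * (\<Sum>s'\<in>S. pmf (kernel M s a) s'))"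
    unfolding policy_kernel_def by (subst sum.swap) (simp add: sum_distrib_left)
  also have "\<dots> = (\<Sum>a\<in>A. pmf (\<pi> s) a * 1)"
    using assms finite_states kernel_subset by (intro sum.cong refl arg_cong2[where f = "(*)"] sum_pmf_eq_1) auto
  finally show ?thesis
    using sum_policy[OF assms] by simp
qed

lemma apply_kernel_le:
  assumes "\<pi> \<in> policies M" "s \<in> S" "\<forall>t\<in>S. f t \<le> B"
  shows "apply_kernel M \<pi> f s \<le> B"
proof -
  have "apply_kernel M \<pi> f s \<le> (\<Sum>t\<in>S. policy_kernel M \<pi> s t * B)"
    using assms unfolding apply_kernel_def
    by (auto simp: policy_kernel_def intro!: sum_mono mult_left_mono sum_nonneg)
  also have "\<dots> = B"
    using sum_policy_kernel[OF assms(1,2)] by (simp flip: sum_distrib_right)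
  finally show ?thesis .
qed

lemma apply_kernel_diff:
  "s \<in> S \<Longrightarrow> apply_kernel M \<pi> f s - apply_kernel M \<pi> g s = apply_kernel M \<pi> (\<lambda>t. f t - g t) s"
  by (simp add: apply_kernel_def sum_subtractf right_diff_distrib)

lemma apply_kernel_linear:
  "s \<in> S \<Longrightarrow> apply_kernel M \<pi> (\<lambda>t. a * f t + b * g t) s
    = a * apply_kernel M \<pi> f s + b * apply_kernel M \<pi> g s"
  by (simp add: apply_kernel_def sum.distrib sum_distrib_left distrib_left mult.left_commute)

text \<open>At a state where \<open>d\<close> attains its maximum \<open>B\<close>, the assumption
  reads \<open>B \<le> b + c * B\<close>. Both \<open>sub_fixpoint_le\<close> and
  \<open>mixture_le\<close> reduce to this bound.\<close>

lemma maximum_principle: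
  assumes \<pi>: "\<pi> \<in> policies M" and c: "0 \<le> c" "c < 1"
    and d: "\<forall>s\<in>S. d s \<le> b + c * apply_kernel M \<pi> d s" and s: "s \<in> S"
  shows "d s \<le> b / (1 - c)"
proof -
  define B where "B = Max (d ` S)"
  have le: "\<forall>t\<in>S. d t \<le> B"
    using finite_states by (simp add: B_def)
  have "B \<in> d ` S"
    unfolding B_def using finite_states states_ne by (intro Max_in) auto
  then obtain t where t: "t \<in> S" "d t = B"
    by blast
  have "B \<le> b + c * apply_kernel M \<pi> d t"
    using d t by auto
  also have "\<dots> \<le> b + c * B"
    using apply_kernel_le[OF \<pi> t(1) le] c by (simp add: mult_left_mono)
  finally have "B \<le> b / (1 - c)"
    using c by (simp add: field_simps)
  with le s show ?thesis
    by force
qed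

section \<open>Bellman operators\<close>

lemma bellman_diff:
  "s \<in> S \<Longrightarrow> bellman M \<pi> f s - bellman M \<pi> g s = \<gamma> * apply_kernel M \<pi> (\<lambda>t. f t - g t) s"
  by (simp add: bellman_def right_diff_distrib flip: apply_kernel_diff)

text \<open>Kept one-sided because \<open>lookahead\<close> will be compared with \<open>v\<close>
  from above only; \<open>D = 0\<close> is monotonicity.\<close>

lemma bellman_shift:
  assumes "\<pi> \<in> policies M" "\<forall>t\<in>S. f t \<le> g t + D" "s \<in> S"
  shows "bellman M \<pi> f s \<le> bellman M \<pi> g s + \<gamma> * D"
proof -
  have "apply_kernel M \<pi> (\<lambda>t. f t - g t) s \<le> D"
    using assms by (intro apply_kernel_le) (auto simp: algebra_simps)
  then show ?thesis
    using bellman_diff[OF assms(3), of \<pi> f g] discount_pos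
    by (smt (verit) mult_left_mono)
qed

lemma bellman_mono:
  assumes "\<pi> \<in> policies M" "\<forall>t\<in>S. f t \<le> g t" "s \<in> S"
  shows "bellman M \<pi> f s \<le> bellman M \<pi> g s"
  using bellman_shift[of \<pi> f g 0] assms by simp

text \<open>The Q-function of \<open>f\<close>: averaging it over the actions gives the operator of
  a policy, maximising it gives the optimality operator.\<close>

definition action_value :: "('s \<Rightarrow> real) \<Rightarrow> 's \<Rightarrow> 'a \<Rightarrow> real" where
  "action_value f s a = reward M s a + \<gamma> * (\<Sum>t\<in>S. pmf (kernel M s a) t * f t)"

lemma bellman_eq_average:
  assumes "s \<in> S"
  shows "bellman M \<pi> f s = (\<Sum>a\<in>A. pmf (\<pi> s) a * action_value f s a)"
proof -
  have "apply_kernel M \<pi> f s = (\<Sum>a\<in>A. pmf (\<pi> s) a * (\<Sum>t\<in>S. pmf (kernel M s a) t * f t))"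
    using assms unfolding apply_kernel_def policy_kernel_def
    by (simp add: sum_distrib_left sum_distrib_right mult.assoc) (rule sum.swap)
  then show ?thesis
    using assms unfolding bellman_def policy_reward_def action_value_def
    by (simp add: sum_distrib_left sum.distrib distrib_left mult.left_commute)
qed

lemma bellman_le_Max:
  assumes "\<pi> \<in> policies M" "s \<in> S"
  shows "bellman M \<pi> f s \<le> Max (action_value f s ` A)"
proof -
  have "bellman M \<pi> f s \<le> (\<Sum>a\<in>A. pmf (\<pi> s) a * Max (action_value f s ` A))"
    unfolding bellman_eq_average[OF assms(2)]
    using finite_actions by (intro sum_mono mult_left_mono) auto
  also have "\<dots> = Max (action_value f s ` A)"
    using sum_policy[OF assms] by (simp flip: sum_distrib_right)
  finally show ?thesis .
qed

lemma bellman_return_pmf: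
  assumes "s \<in> S" "\<pi> s = return_pmf a" "a \<in> A"
  shows "bellman M \<pi> f s = action_value f s a"
proof -
  have "bellman M \<pi> f s = (\<Sum>b\<in>A. if b = a then action_value f s a else 0)"
    unfolding bellman_eq_average[OF assms(1)]
    by (intro sum.cong) (auto simp: assms(2) pmf_return)
  then show ?thesis
    using assms(3) finite_actions by simp
qed

text \<open>Choosing a maximising action at each state gives one deterministic policy that is best
  at all states at once, so the statewise supremum in \<open>bellman_opt\<close> is attained by a
  single policy.\<close>

lemma greedy_policy_exists:
  "\<exists>\<pi>\<in>policies M. \<forall>s\<in>S. bellman M \<pi> f s = Max (action_value f s ` A)"
proof -
  have "Max (action_value f s ` A) \<in> action_value f s ` A" for s
    using finite_actions actions_ne by (intro Max_in) auto
  then have "\<exists>a. a \<in> A \<and> action_value f s a = Max (action_value f s ` A)" for s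
    by (metis imageE)
  then obtain g where g: "\<And>s. g s \<in> A" "\<And>s. action_value f s (g s) = Max (action_value f s ` A)"
    by metis
  then have "(\<lambda>s. return_pmf (g s)) \<in> policies M"
    by (auto simp: policies_def)
  moreover have "bellman M (\<lambda>s. return_pmf (g s)) f s = Max (action_value f s ` A)" if "s \<in> S" for s
    using that g bellman_return_pmf by simp
  ultimately show ?thesis
    by blast
qed

lemma bellman_opt_eq_Max:
  assumes "s \<in> S"
  shows "bellman_opt M f s = Max (action_value f s ` A)"
proof -
  obtain \<pi> where "\<pi> \<in> policies M" "bellman M \<pi> f s = Max (action_value f s ` A)"
    using greedy_policy_exists assms by blast
  then have "(SUP \<pi>\<in>policies M. bellman M \<pi> f s) = Max (action_value f s ` A)"
    using bellman_le_Max[OF _ assms] by (intro cSup_eq_maximum) (auto intro: rev_image_eqI)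
  then show ?thesis
    using assms by (simp add: bellman_opt_def)
qed

lemma bellman_le_opt:
  "\<pi> \<in> policies M \<Longrightarrow> s \<in> S \<Longrightarrow> bellman M \<pi> f s \<le> bellman_opt M f s"
  by (simp add: bellman_opt_eq_Max bellman_le_Max)

lemma bellman_opt_attained: "\<exists>\<pi>\<in>policies M. \<forall>s\<in>S. bellman M \<pi> f s = bellman_opt M f s"
  using greedy_policy_exists[of f] by (simp add: bellman_opt_eq_Max)

lemma bellman_opt_shift:
  assumes "\<forall>t\<in>S. f t \<le> g t + D" "s \<in> S"
  shows "bellman_opt M f s \<le> bellman_opt M g s + \<gamma> * D"
proof -
  obtain \<pi> where \<pi>: "\<pi> \<in> policies M" "\<forall>s\<in>S. bellman M \<pi> f s = bellman_opt M f s"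
    using bellman_opt_attained by blast
  then show ?thesis
    using bellman_shift[OF \<pi>(1) assms] bellman_le_opt[OF \<pi>(1) assms(2), of g] assms(2) by simp
qed

lemma bellman_opt_contraction:
  assumes "\<forall>t\<in>S. \<bar>f t - g t\<bar> \<le> D" "s \<in> S"
  shows "\<bar>bellman_opt M f s - bellman_opt M g s\<bar> \<le> \<gamma> * D"
proof -
  have "\<forall>t\<in>S. f t \<le> g t + D" "\<forall>t\<in>S. g t \<le> f t + D"
    using assms by (auto simp: abs_le_iff algebra_simps)
  then show ?thesis
    using bellman_opt_shift[of f g D s] bellman_opt_shift[of g f D s] assms(2) by (simp add: abs_le_iff)
qed

section \<open>Resolvents and the optimal value\<close>

text \<open>\<open>inv_into\<close> inverts only on the image, so \<open>b\<close> must be shown to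
  have a preimage: it is the fixed point of \<open>u \<mapsto> b + c P u\<close>, a contraction with
  factor \<open>c\<close>.\<close>

lemma resolvent_eq:
  assumes \<pi>: "\<pi> \<in> policies M" and c: "0 \<le> c" "c < 1" and b: "b \<in> value_functions M"
    and s: "s \<in> S"
  shows "resolvent M \<pi> c b s = b s + c * apply_kernel M \<pi> (resolvent M \<pi> c b) s"
proof -
  let ?L = "\<lambda>w. \<lambda>s\<in>S. w s - c * apply_kernel M \<pi> w s"
  have "\<exists>u\<in>S \<rightarrow>\<^sub>E UNIV. \<forall>s\<in>S. b s + c * apply_kernel M \<pi> u s = u s"
  proof (rule sup_contraction_fixpoint[OF finite_states c])
    fix u v :: "'s \<Rightarrow> real" and D
    assume D: "\<forall>s\<in>S. \<bar>u s - v s\<bar> \<le> D"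
    show "\<forall>s\<in>S. \<bar>b s + c * apply_kernel M \<pi> u s - (b s + c * apply_kernel M \<pi> v s)\<bar> \<le> c * D"
    proof
      fix s assume s: "s \<in> S"
      have "apply_kernel M \<pi> u s - apply_kernel M \<pi> v s \<le> D"
        using D \<pi> s by (simp add: apply_kernel_diff apply_kernel_le abs_le_iff)
      moreover have "apply_kernel M \<pi> v s - apply_kernel M \<pi> u s \<le> D"
        using D \<pi> s by (simp add: apply_kernel_diff apply_kernel_le abs_le_iff)
      ultimately have "\<bar>apply_kernel M \<pi> u s - apply_kernel M \<pi> v s\<bar> \<le> D"
        by simp
      then have "c * \<bar>apply_kernel M \<pi> u s - apply_kernel M \<pi> v s\<bar> \<le> c * D"
        using c by (simp add: mult_left_mono)
      then show "\<bar>b s + c * apply_kernel M \<pi> u s - (b s + c * apply_kernel M \<pi> v s)\<bar> \<le> c * D"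
        using c by (simp add: abs_mult flip: right_diff_distrib)
    qed
  qed
  then obtain u where u: "u \<in> value_functions M" "\<forall>s\<in>S. b s + c * apply_kernel M \<pi> u s = u s"
    unfolding value_functions_def by blast
  \<comment> \<open>This is an equality of functions: outside \<open>S\<close> both sides are
    \<open>undefined\<close>, since \<open>b\<close> is extensional.\<close>
  have "?L u = b"
    using u(2) b by (intro ext) (auto simp: value_functions_def PiE_def extensional_def algebra_simps)
  with u(1) have "b \<in> ?L ` value_functions M"
    by blast
  then have "?L (resolvent M \<pi> c b) = b"
    unfolding resolvent_def by (rule f_inv_into_f)
  from fun_cong[OF this, of s] s show ?thesis
    by simp
qed

lemma policy_value_fixpoint:
  assumes "\<pi> \<in> policies M" "s \<in> S"
  shows "bellman M \<pi> (policy_value M \<pi>) s = policy_value M \<pi> s"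
  using resolvent_eq[OF assms(1) _ discount_less_1 _ assms(2), of "policy_reward M \<pi>"] discount_pos assms(2)
  by (simp add: policy_value_def bellman_def policy_reward_def value_functions_def)

text \<open>Comparison of a subsolution with a supersolution: their difference \<open>d\<close>
  satisfies \<open>d \<le> \<gamma> P d\<close>, and the maximum principle applies with
  \<open>b = 0\<close>.\<close>

lemma sub_fixpoint_le:
  assumes \<pi>: "\<pi> \<in> policies M" and f: "\<forall>s\<in>S. f s \<le> bellman M \<pi> f s"
    and g: "\<forall>s\<in>S. bellman M \<pi> g s \<le> g s" and s: "s \<in> S"
  shows "f s \<le> g s"
proof -
  have "\<forall>s\<in>S. f s - g s \<le> 0 + \<gamma> * apply_kernel M \<pi> (\<lambda>t. f t - g t) s"
    using f g by (force simp flip: bellman_diff)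
  then have "f s - g s \<le> 0 / (1 - \<gamma>)"
    using discount_pos discount_less_1 by (intro maximum_principle[OF \<pi> _ _ _ s]) auto
  then show ?thesis
    by simp
qed

text \<open>A fixed point \<open>u\<close> of the optimality operator is a supersolution for every
  policy, hence dominates its value; a policy greedy for \<open>u\<close> has value exactly
  \<open>u\<close>. This also computes \<open>v_opt\<close> in the example.\<close>

lemma opt_value_eqI:
  assumes u: "u \<in> value_functions M" and fp: "\<forall>s\<in>S. bellman_opt M u s = u s"
  shows "v_opt = u"
proof -
  obtain \<pi> where \<pi>: "\<pi> \<in> policies M" "\<forall>s\<in>S. bellman M \<pi> u s = bellman_opt M u s"
    using bellman_opt_attained by blast
  have eq: "(SUP \<pi>\<in>policies M. policy_value M \<pi> s) = u s" if s: "s \<in> S" for s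
  proof (rule cSup_eq_maximum)
    have "policy_value M \<pi> s = u s"
      using sub_fixpoint_le[OF \<pi>(1), of "policy_value M \<pi>" u] sub_fixpoint_le[OF \<pi>(1), of u "policy_value M \<pi>"]
        \<pi> fp s policy_value_fixpoint[OF \<pi>(1)] by (simp add: antisym)
    then show "u s \<in> (\<lambda>\<pi>. policy_value M \<pi> s) ` policies M"
      using \<pi>(1) by force
  next
    fix x assume "x \<in> (\<lambda>\<pi>. policy_value M \<pi> s) ` policies M"
    then obtain \<pi>' where \<pi>': "\<pi>' \<in> policies M" "x = policy_value M \<pi>' s"
      by blast
    then show "x \<le> u s"
      using sub_fixpoint_le[OF \<pi>'(1), of "policy_value M \<pi>'" u] policy_value_fixpoint[OF \<pi>'(1)]
        bellman_le_opt[OF \<pi>'(1), of _ u] fp s by simp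
  qed
  show ?thesis
    using eq u by (intro ext) (auto simp: opt_value_def value_functions_def PiE_def extensional_def)
qed

lemma opt_value_fixpoint:
  assumes "s \<in> S"
  shows "bellman_opt M v_opt s = v_opt s"
proof -
  have "\<exists>u\<in>S \<rightarrow>\<^sub>E UNIV. \<forall>s\<in>S. bellman_opt M u s = u s"
    using finite_states discount_pos discount_less_1 bellman_opt_contraction
    by (intro sup_contraction_fixpoint[where c = \<gamma>]) auto
  then obtain u where "u \<in> value_functions M" "\<forall>s\<in>S. bellman_opt M u s = u s"
    unfolding value_functions_def by blast
  then show ?thesis
    using opt_value_eqI[of u] assms by simp
qed

lemma bellman_opt_value_le: "\<pi> \<in> policies M \<Longrightarrow> s \<in> S \<Longrightarrow> bellman M \<pi> v_opt s \<le> v_opt s"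
  using bellman_le_opt[of \<pi> s v_opt] opt_value_fixpoint[of s] by simp

section \<open>Sup-norm distance and iterated operators\<close>

lemma sup_dist_le_iff: "sup_dist M f g \<le> B \<longleftrightarrow> (\<forall>s\<in>S. \<bar>f s - g s\<bar> \<le> B)"
  using finite_states states_ne by (simp add: sup_dist_def)

lemma sup_dist_ge: "s \<in> S \<Longrightarrow> \<bar>f s - g s\<bar> \<le> sup_dist M f g"
  using finite_states by (simp add: sup_dist_def)

lemma sup_dist_nonneg: "0 \<le> sup_dist M f g"
  using states_ne sup_dist_ge by (meson abs_ge_zero ex_in_conv order_trans)

lemma value_iteration_error:
  "s \<in> S \<Longrightarrow> \<bar>v_opt s - (bellman_opt M ^^ n) v s\<bar> \<le> \<gamma> ^ n * sup_dist M v_opt v"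
proof (induction n arbitrary: s)
  case 0
  then show ?case by (simp add: sup_dist_ge)
next
  case (Suc n)
  then show ?case
    using bellman_opt_contraction[of v_opt "(bellman_opt M ^^ n) v" "\<gamma> ^ n * sup_dist M v_opt v" s]
      opt_value_fixpoint[of s] by (simp add: mult.assoc)
qed

lemma bellman_iterate_shift:
  assumes "\<pi> \<in> policies M" "\<forall>t\<in>S. f t \<le> g t + D" "s \<in> S"
  shows "(bellman M \<pi> ^^ n) f s \<le> (bellman M \<pi> ^^ n) g s + \<gamma> ^ n * D"
  using assms(3)
proof (induction n arbitrary: s)
  case 0
  then show ?case using assms(2) by simp
next
  case (Suc n)
  then show ?case
    using bellman_shift[OF assms(1), of "(bellman M \<pi> ^^ n) f" "(bellman M \<pi> ^^ n) g"]
    by (simp add: mult.assoc)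
qed

section \<open>The lambda-return as a fixed point\<close>

text \<open>Trades the resolvent for an equation in \<open>bellman\<close>, which is accessible to
  monotonicity and to the maximum principle.\<close>

lemma lambda_return_fixpoint:
  assumes \<pi>: "\<pi> \<in> policies M" and l: "0 \<le> l" "l \<le> 1" and s: "s \<in> S"
  shows "lambda_return M l \<pi> v s
    = bellman M \<pi> (\<lambda>t. (1 - l) * v t + l * lambda_return M l \<pi> v t) s"
proof -
  define b where "b = (\<lambda>t\<in>S. bellman M \<pi> v t - v t)"
  define y where "y = resolvent M \<pi> (\<gamma> * l) b"
  have lr: "lambda_return M l \<pi> v t = v t + y t" if "t \<in> S" for t
    using that by (simp add: lambda_return_def y_def b_def)
  have "\<gamma> * l \<le> \<gamma> * 1"
    using l discount_pos by (intro mult_left_mono) auto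
  then have "\<gamma> * l < 1"
    using discount_less_1 by simp
  then have "y s = b s + \<gamma> * l * apply_kernel M \<pi> y s"
    unfolding y_def using \<pi> l s discount_pos discount_less_1
    by (intro resolvent_eq) (auto simp: b_def value_functions_def)
  then have "lambda_return M l \<pi> v s = bellman M \<pi> v s + \<gamma> * (l * apply_kernel M \<pi> y s)"
    using s by (simp add: lr b_def)
  \<comment> \<open>Since the return is \<open>v + y\<close>, the mixture differs from
    \<open>v\<close> by exactly \<open>l * y\<close>.\<close>
  also have "l * apply_kernel M \<pi> y s
      = apply_kernel M \<pi> (\<lambda>t. ((1 - l) * v t + l * lambda_return M l \<pi> v t) - v t) s"
    using s by (simp add: apply_kernel_def sum_distrib_left lr left_diff_distrib distrib_left
        mult.left_commute cong: sum.cong)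
  finally show ?thesis
    using bellman_diff[OF s, of \<pi> "\<lambda>t. (1 - l) * v t + l * lambda_return M l \<pi> v t" v] by simp
qed

text \<open>The difference \<open>d = f' - g'\<close> satisfies
  \<open>d \<le> \<gamma> (1 - l) D + l \<gamma> P d\<close>, and the maximum principle yields the
  constant. The single inequality \<open>le\<close> lets either side be a solution of its equation,
  or \<open>f'\<close> a subsolution and \<open>g'\<close> a supersolution.\<close>

lemma mixture_le:
  assumes \<pi>: "\<pi> \<in> policies M" and l: "0 \<le> l" "l \<le> 1" and s: "s \<in> S"
    and le: "\<forall>s\<in>S. f' s - g' s \<le> bellman M \<pi> (\<lambda>t. (1 - l) * f t + l * f' t) s
                               - bellman M \<pi> (\<lambda>t. (1 - l) * g t + l * g' t) s"
    and fg: "\<forall>s\<in>S. f s - g s \<le> D"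
  shows "f' s - g' s \<le> \<gamma> * (1 - l) / (1 - l * \<gamma>) * D"
proof -
  have c: "l * \<gamma> < 1"
    using mult_right_mono[of l 1 \<gamma>] l discount_pos discount_less_1 by linarith
  have "f' t - g' t \<le> \<gamma> * (1 - l) * D + l * \<gamma> * apply_kernel M \<pi> (\<lambda>t. f' t - g' t) t" if t: "t \<in> S" for t
  proof -
    have "apply_kernel M \<pi> (\<lambda>t. f t - g t) t \<le> D"
      using \<pi> t fg by (rule apply_kernel_le)
    then have 1: "\<gamma> * (1 - l) * apply_kernel M \<pi> (\<lambda>t. f t - g t) t \<le> \<gamma> * (1 - l) * D"
      using l discount_pos by (intro mult_left_mono) auto
    have "(\<lambda>t. ((1 - l) * f t + l * f' t) - ((1 - l) * g t + l * g' t))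
        = (\<lambda>t. (1 - l) * (f t - g t) + l * (f' t - g' t))"
      by (simp add: algebra_simps)
    then have "f' t - g' t \<le> \<gamma> * apply_kernel M \<pi> (\<lambda>t. (1 - l) * (f t - g t) + l * (f' t - g' t)) t"
      using bspec[OF le t] bellman_diff[OF t] by simp
    also have "\<dots> = \<gamma> * (1 - l) * apply_kernel M \<pi> (\<lambda>t. f t - g t) t
        + l * \<gamma> * apply_kernel M \<pi> (\<lambda>t. f' t - g' t) t"
      using t by (simp add: apply_kernel_linear distrib_left)
    finally show ?thesis
      using 1 by simp
  qed
  then have "f' s - g' s \<le> \<gamma> * (1 - l) * D / (1 - l * \<gamma>)"
    using maximum_principle[OF \<pi> _ c _ s, of "\<lambda>t. f' t - g' t" "\<gamma> * (1 - l) * D"] l discount_pos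
    by simp
  then show ?thesis
    by simp
qed

section \<open>Error bounds under greedy consistency\<close>

context
  fixes h :: nat and v \<pi>
  assumes h: "h > 1" and greedy: "\<pi> \<in> greedy_policies M h v"
    and consistent: "greedy_consistent M h v \<pi>"
begin

abbreviation "lookahead \<equiv> (bellman_opt M ^^ (h - 1)) v"
abbreviation "D \<equiv> sup_dist M v_opt v"

lemma greedy_policy: "\<pi> \<in> policies M"
  using greedy by (simp add: greedy_policies_def)

lemma bellman_lookahead: "bellman M \<pi> lookahead = (bellman_opt M ^^ h) v"
  using greedy by (simp add: greedy_policies_def)

lemma lookahead_le_bellman: "\<forall>s\<in>S. lookahead s \<le> bellman M \<pi> lookahead s"
  using consistent by (simp add: greedy_consistent_def)

text \<open>By consistency \<open>lookahead\<close> is a subsolution for \<open>\<pi>\<close>, while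
  \<open>v_opt\<close> is a supersolution; they are compared directly, without a limit of
  iterates.\<close>

lemma lookahead_le_opt: "s \<in> S \<Longrightarrow> lookahead s \<le> v_opt s"
  by (rule sub_fixpoint_le[OF greedy_policy lookahead_le_bellman])
    (simp_all add: bellman_opt_value_le greedy_policy)

text \<open>Passing through \<open>v_opt\<close> without absolute values costs only
  \<open>D\<close>; the triangle inequality would give
  \<open>(1 + \<gamma> ^ (h - 1)) * D\<close>.\<close>

lemma lookahead_minus_le: "s \<in> S \<Longrightarrow> lookahead s - v s \<le> D"
  using lookahead_le_opt[of s] sup_dist_ge[of s v_opt v] by simp

lemma opt_le_bellman_lookahead: "s \<in> S \<Longrightarrow> v_opt s - bellman M \<pi> lookahead s \<le> \<gamma> ^ h * D"
  using value_iteration_error[of s h v] unfolding bellman_lookahead by simp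

lemma multi_step_error:
  assumes "m \<ge> 1"
  shows "sup_dist M v_opt ((bellman M \<pi> ^^ m) v) \<le> (\<gamma> ^ m + \<gamma> ^ h) * D"
  unfolding sup_dist_le_iff
proof
  fix s assume s: "s \<in> S"
  \<comment> \<open>Consistency and the induction hypothesis place \<open>lookahead\<close> below
    its iterate of order \<open>Suc n\<close>; one more monotone application of the operator
    completes the step.\<close>
  have incr: "bellman M \<pi> lookahead s \<le> (bellman M \<pi> ^^ Suc n) lookahead s" if "s \<in> S" for n s
    using that
  proof (induction n arbitrary: s)
    case (Suc n)
    then have "\<forall>t\<in>S. lookahead t \<le> (bellman M \<pi> ^^ Suc n) lookahead t"
      using lookahead_le_bellman by force
    with Suc.prems show ?case
      using bellman_mono[OF greedy_policy, of lookahead "(bellman M \<pi> ^^ Suc n) lookahead"] by simp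
  qed simp
  have "(bellman M \<pi> ^^ m) lookahead s \<le> (bellman M \<pi> ^^ m) v s + \<gamma> ^ m * D"
    using lookahead_minus_le
    by (intro bellman_iterate_shift greedy_policy s) (auto simp: algebra_simps)
  moreover have "bellman M \<pi> lookahead s \<le> (bellman M \<pi> ^^ m) lookahead s"
    using incr[OF s, of "m - 1"] assms by simp
  ultimately have upper: "v_opt s - (bellman M \<pi> ^^ m) v s \<le> (\<gamma> ^ m + \<gamma> ^ h) * D"
    using opt_le_bellman_lookahead[OF s] by (simp add: distrib_right)
  \<comment> \<open>For the reverse inequality, iterates started at the supersolution
    \<open>v_opt\<close> stay below it. This side costs only \<open>\<gamma> ^ m * D\<close>; the
    other term is slack.\<close>
  have "(bellman M \<pi> ^^ n) v_opt s \<le> v_opt s" if "s \<in> S" for n s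
    using that
  proof (induction n arbitrary: s)
    case (Suc n)
    then show ?case
      using bellman_mono[OF greedy_policy, of "(bellman M \<pi> ^^ n) v_opt" v_opt]
        bellman_opt_value_le[OF greedy_policy] by force
  qed simp
  moreover have "(bellman M \<pi> ^^ m) v s \<le> (bellman M \<pi> ^^ m) v_opt s + \<gamma> ^ m * D"
    using sup_dist_ge[of _ v_opt v]
    by (intro bellman_iterate_shift greedy_policy s) (force simp: abs_le_iff)
  moreover have "0 \<le> \<gamma> ^ h * D"
    using discount_pos sup_dist_nonneg by simp
  ultimately have "(bellman M \<pi> ^^ m) v s - v_opt s \<le> (\<gamma> ^ m + \<gamma> ^ h) * D"
    using s by (smt (verit) distrib_right)
  with upper show "\<bar>v_opt s - (bellman M \<pi> ^^ m) v s\<bar> \<le> (\<gamma> ^ m + \<gamma> ^ h) * D"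
    by (simp add: abs_le_iff)
qed

lemma lambda_return_error:
  assumes l: "0 \<le> l" "l \<le> 1"
  shows "sup_dist M v_opt (lambda_return M l \<pi> v)
    \<le> (\<gamma> * (1 - l) / (1 - l * \<gamma>) + \<gamma> ^ h) * D"
  unfolding sup_dist_le_iff
proof
  fix s assume s: "s \<in> S"
  let ?x = "lambda_return M l \<pi> v" and ?z = "lambda_return M l \<pi> lookahead"
  let ?u = "bellman M \<pi> lookahead" and ?k = "\<gamma> * (1 - l) / (1 - l * \<gamma>)"
  note fp = lambda_return_fixpoint[OF greedy_policy l]
  \<comment> \<open>With equal base functions the bound is zero: \<open>?u\<close> is a subsolution
    of the equation solved by \<open>?z\<close>, because consistency gives
    \<open>lookahead \<le> (1 - l) * lookahead + l * ?u\<close>.\<close>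
  have "?u s - ?z s \<le> ?k * 0"
  proof (rule mixture_le[OF greedy_policy l s])
    show "\<forall>s\<in>S. lookahead s - lookahead s \<le> 0"
      by simp
    have le: "lookahead t \<le> (1 - l) * lookahead t + l * ?u t" if "t \<in> S" for t
    proof -
      have "0 \<le> l * (?u t - lookahead t)"
        using l lookahead_le_bellman that by simp
      then show ?thesis
        by (simp add: algebra_simps)
    qed
    show "\<forall>s\<in>S. ?u s - ?z s \<le> bellman M \<pi> (\<lambda>t. (1 - l) * lookahead t + l * ?u t) s
        - bellman M \<pi> (\<lambda>t. (1 - l) * lookahead t + l * ?z t) s"
      using bellman_mono[OF greedy_policy, of lookahead "\<lambda>t. (1 - l) * lookahead t + l * ?u t"] le
      by (simp flip: fp)
  qed
  moreover have "?z s - ?x s \<le> ?k * D"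
    using fp lookahead_minus_le
    by (intro mixture_le[OF greedy_policy l s, where f = lookahead and g = v]) auto
  ultimately have upper: "v_opt s - ?x s \<le> (?k + \<gamma> ^ h) * D"
    using opt_le_bellman_lookahead[OF s] by (simp add: distrib_right)
  have "?x s - v_opt s \<le> ?k * D"
  proof (rule mixture_le[OF greedy_policy l s])
    show "\<forall>s\<in>S. v s - v_opt s \<le> D"
      using sup_dist_ge[of _ v_opt v] by (force simp: abs_le_iff)
    \<comment> \<open>Mixed with itself, \<open>v_opt\<close> is unchanged, so it is a supersolution
      of its own mixture equation.\<close>
    have "(\<lambda>t. (1 - l) * v_opt t + l * v_opt t) = v_opt"
      by (simp add: left_diff_distrib)
    then show "\<forall>s\<in>S. ?x s - v_opt s \<le> bellman M \<pi> (\<lambda>t. (1 - l) * v t + l * ?x t) s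
        - bellman M \<pi> (\<lambda>t. (1 - l) * v_opt t + l * v_opt t) s"
      using bellman_opt_value_le[OF greedy_policy] by (simp flip: fp)
  qed
  moreover have "0 \<le> \<gamma> ^ h * D"
    using discount_pos sup_dist_nonneg by simp
  ultimately have "?x s - v_opt s \<le> (?k + \<gamma> ^ h) * D"
    by (simp add: distrib_right)
  with upper show "\<bar>v_opt s - ?x s\<bar> \<le> (?k + \<gamma> ^ h) * D"
    by (simp add: abs_le_iff)
qed

end

end

section \<open>An example attaining both bounds\<close>

text \<open>State 0 is the start, 1 the loop, 2 its exit, 3 the absorbing state with value \<open>-1\<close>.\<close>

definition tight_step :: "nat \<Rightarrow> nat \<Rightarrow> nat" where
  "tight_step s a = (if s = 0 then (if a = 0 then 1 else 3) else if s = 1 \<and> a = 1 then 2 else s)"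

text \<open>The reward \<open>\<gamma> ^ h\<close> exactly cancels the discounted \<open>- 1\<close>
  of state 3 as seen with \<open>h\<close> steps of lookahead, which makes the two actions at state
  0 tie. The true value of state 3 is 0, so the action refused by \<open>tight_policy\<close> is
  really worth \<open>\<gamma> ^ h\<close>.\<close>

definition tight_mdp :: "nat \<Rightarrow> real \<Rightarrow> (nat, nat) mdp" where
  "tight_mdp h \<gamma> = \<lparr>states = {0, 1, 2, 3}, actions = {0, 1},
     kernel = (\<lambda>s a. return_pmf (tight_step s a)),
     reward = (\<lambda>s a. if s = 0 \<and> a = 1 then \<gamma> ^ h else 0), discount = \<gamma>\<rparr>"

definition tight_value :: "nat \<Rightarrow> real" where
  "tight_value = (\<lambda>s\<in>{0, 1, 2, 3}. if s = 1 \<or> s = 3 then - 1 else 0)"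

lemma tight_value_simps [simp]:
  "tight_value 0 = 0" "tight_value (Suc 0) = - 1" "tight_value 2 = 0" "tight_value 3 = - 1"
  by (simp_all add: tight_value_def)

abbreviation tight_policy :: "nat \<Rightarrow> nat pmf" where
  "tight_policy \<equiv> \<lambda>_. return_pmf 0"

context
  fixes h :: nat and \<gamma> :: real
  assumes h: "h > 1" and \<gamma>: "0 < \<gamma>" "\<gamma> < 1"
begin

lemma tight_mdp_simps [simp]:
  "states (tight_mdp h \<gamma>) = {0, 1, 2, 3}" "actions (tight_mdp h \<gamma>) = {0, 1}"
  "kernel (tight_mdp h \<gamma>) s a = return_pmf (tight_step s a)"
  "reward (tight_mdp h \<gamma>) s a = (if s = 0 \<and> a = 1 then \<gamma> ^ h else 0)"
  "discount (tight_mdp h \<gamma>) = \<gamma>"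
  by (simp_all add: tight_mdp_def)

interpretation tight: mdp_model "tight_mdp h \<gamma>"
  by unfold_locales (auto simp: finite_mdp_def \<gamma> tight_step_def)

lemma tight_action_value:
  assumes "s \<in> {0, 1, 2, 3}"
  shows "tight.action_value f s a = (if s = 0 \<and> a = 1 then \<gamma> ^ h else 0) + \<gamma> * f (tight_step s a)"
proof -
  have "(\<Sum>t\<in>{0, 1, 2, 3}. pmf (return_pmf (tight_step s a)) t * f t)
      = (\<Sum>t\<in>{0, 1, 2, 3}. if t = tight_step s a then f t else 0)"
    by (intro sum.cong) (auto simp: pmf_return)
  also have "\<dots> = f (tight_step s a)"
    using assms by (subst sum.delta) (auto simp: tight_step_def)
  finally show ?thesis
    by (simp add: tight.action_value_def)
qed

lemma tight_bellman_opt: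
  "bellman_opt (tight_mdp h \<gamma>) f 0 = max (\<gamma> * f 1) (\<gamma> ^ h + \<gamma> * f 3)"
  "bellman_opt (tight_mdp h \<gamma>) f 1 = max (\<gamma> * f 1) (\<gamma> * f 2)"
  "bellman_opt (tight_mdp h \<gamma>) f 2 = \<gamma> * f 2"
  "bellman_opt (tight_mdp h \<gamma>) f 3 = \<gamma> * f 3"
  by (simp_all add: tight.bellman_opt_eq_Max tight_action_value) (simp_all add: tight_step_def)

lemma tight_bellman:
  "bellman (tight_mdp h \<gamma>) tight_policy f 0 = \<gamma> * f 1"
  "s \<in> {1, 2, 3} \<Longrightarrow> bellman (tight_mdp h \<gamma>) tight_policy f s = \<gamma> * f s"
  by (auto simp: tight.bellman_return_pmf[where a = 0] tight_action_value tight_step_def)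

lemma tight_opt_value:
  "opt_value (tight_mdp h \<gamma>) = (\<lambda>s\<in>{0, 1, 2, 3}. if s = 0 then \<gamma> ^ h else 0)"
  using \<gamma> by (intro tight.opt_value_eqI) (auto simp: value_functions_def tight_bellman_opt[simplified])

text \<open>The errors at states 0, 1, 2, 3 are \<open>\<gamma> ^ h\<close>, 1, 0, 1.\<close>

lemma tight_sup_dist: "sup_dist (tight_mdp h \<gamma>) (opt_value (tight_mdp h \<gamma>)) tight_value = 1"
proof (rule antisym)
  show "sup_dist (tight_mdp h \<gamma>) (opt_value (tight_mdp h \<gamma>)) tight_value \<le> 1"
    using \<gamma> by (auto simp: tight.sup_dist_le_iff tight_opt_value power_le_one)
  show "1 \<le> sup_dist (tight_mdp h \<gamma>) (opt_value (tight_mdp h \<gamma>)) tight_value"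
    using tight.sup_dist_ge[of 1 "opt_value (tight_mdp h \<gamma>)" tight_value]
    by (simp add: tight_opt_value)
qed

lemma tight_value_iteration:
  "(bellman_opt (tight_mdp h \<gamma>) ^^ n) tight_value 2 = 0"
  "(bellman_opt (tight_mdp h \<gamma>) ^^ n) tight_value 3 = - (\<gamma> ^ n)"
  "(bellman_opt (tight_mdp h \<gamma>) ^^ n) tight_value 1 = (if n = 0 then - 1 else 0)"
proof -
  show 2: "(bellman_opt (tight_mdp h \<gamma>) ^^ n) tight_value 2 = 0" for n
    by (induction n) (simp_all add: tight_bellman_opt)
  show "(bellman_opt (tight_mdp h \<gamma>) ^^ n) tight_value 3 = - (\<gamma> ^ n)"
    by (induction n) (simp_all add: tight_bellman_opt)
  show "(bellman_opt (tight_mdp h \<gamma>) ^^ n) tight_value 1 = (if n = 0 then - 1 else 0)"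
    using \<gamma> by (induction n) (auto simp: tight_bellman_opt[simplified] 2)
qed

text \<open>Ties at states 0 and 1 make the bad choices greedy. At state 1 this uses
  \<open>h > 1\<close>: after at least one iteration the loop already has the value 0 of its
  exit.\<close>

lemma tight_greedy: "tight_policy \<in> greedy_policies (tight_mdp h \<gamma>) h tight_value"
proof -
  have "bellman (tight_mdp h \<gamma>) tight_policy ((bellman_opt (tight_mdp h \<gamma>) ^^ (h - 1)) tight_value) s
      = bellman_opt (tight_mdp h \<gamma>) ((bellman_opt (tight_mdp h \<gamma>) ^^ (h - 1)) tight_value) s" for s
  proof (cases "s \<in> {0, 1, 2, 3}")
    case True
    then show ?thesis
      using tight_value_iteration[of "h - 1"] h
      by (auto simp: tight_bellman[simplified] tight_bellman_opt[simplified] simp flip: power_Suc)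
  next
    case False
    then show ?thesis
      by (simp add: bellman_def bellman_opt_def)
  qed
  moreover have "(bellman_opt (tight_mdp h \<gamma>) ^^ h) tight_value
      = bellman_opt (tight_mdp h \<gamma>) ((bellman_opt (tight_mdp h \<gamma>) ^^ (h - 1)) tight_value)"
    using h by (cases h) auto
  ultimately show ?thesis
    by (auto simp: greedy_policies_def policies_def)
qed

text \<open>At states 1 and 2 both sides are 0, and at state 3 the claim is
  \<open>\<gamma> ^ h \<le> \<gamma> ^ (h - 1)\<close>. State 0 needs a nonpositive lookahead
  value.\<close>

lemma tight_consistent: "greedy_consistent (tight_mdp h \<gamma>) h tight_value tight_policy"
proof -
  obtain k where k: "h = Suc (Suc k)"
    using h by (metis One_nat_def less_imp_Suc_add add_Suc plus_nat.simps(1))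
  have "\<gamma> ^ h \<le> \<gamma> ^ (h - 1)"
    using \<gamma> by (intro power_decreasing) auto
  moreover have "(bellman_opt (tight_mdp h \<gamma>) ^^ (h - 1)) tight_value 0 \<le> 0"
  proof -
    have "h - 1 = Suc k"
      by (simp add: k)
    \<comment> \<open>With one step of lookahead fewer than \<open>h\<close>, moving from 0 to 3 is
      worth \<open>\<gamma> ^ h - \<gamma> ^ Suc k\<close>, which is not positive.\<close>
    have "\<gamma> ^ h \<le> \<gamma> ^ Suc k"
      using \<gamma> k by (intro power_decreasing) auto
    then show ?thesis
      using tight_value_iteration[of k] \<gamma> unfolding \<open>h - 1 = Suc k\<close>
      by (simp add: tight_bellman_opt[simplified])
  qed
  ultimately show ?thesis
    using tight_value_iteration[of "h - 1"] h \<gamma>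
    by (auto simp: greedy_consistent_def tight_bellman[simplified] simp flip: power_Suc)
qed

text \<open>The lower bound is read off at state 0, whose optimal value is
  \<open>\<gamma> ^ h\<close>: the policy moves to state 1 and loops there, so \<open>m\<close>
  steps give \<open>- (\<gamma> ^ m)\<close>.\<close>

lemma tight_multi_step_error:
  assumes "m \<ge> 1"
  shows "sup_dist (tight_mdp h \<gamma>) (opt_value (tight_mdp h \<gamma>))
    ((bellman (tight_mdp h \<gamma>) tight_policy ^^ m) tight_value) = \<gamma> ^ m + \<gamma> ^ h"
proof (rule antisym)
  show "sup_dist (tight_mdp h \<gamma>) (opt_value (tight_mdp h \<gamma>))
    ((bellman (tight_mdp h \<gamma>) tight_policy ^^ m) tight_value) \<le> \<gamma> ^ m + \<gamma> ^ h"
    using tight.multi_step_error[OF h tight_greedy tight_consistent assms] by (simp add: tight_sup_dist)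
  have 1: "(bellman (tight_mdp h \<gamma>) tight_policy ^^ n) tight_value 1 = - (\<gamma> ^ n)" for n
    by (induction n) (simp_all add: tight_bellman[simplified])
  obtain n where n: "m = Suc n"
    using assms by (cases m) auto
  have "(bellman (tight_mdp h \<gamma>) tight_policy ^^ m) tight_value 0 = - (\<gamma> ^ m)"
    using 1[of n] by (simp add: n tight_bellman[simplified])
  then show "\<gamma> ^ m + \<gamma> ^ h \<le> sup_dist (tight_mdp h \<gamma>) (opt_value (tight_mdp h \<gamma>))
    ((bellman (tight_mdp h \<gamma>) tight_policy ^^ m) tight_value)"
    using tight.sup_dist_ge[of 0 "opt_value (tight_mdp h \<gamma>)"
        "(bellman (tight_mdp h \<gamma>) tight_policy ^^ m) tight_value"] \<gamma>
    by (simp add: tight_opt_value)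
qed

text \<open>The policy sends both 0 and 1 to state 1, so both returns equal the solution of
  \<open>x = \<gamma> * (l * x - (1 - l))\<close>; state 0 again attains the bound.\<close>

lemma tight_lambda_return_error:
  assumes l: "0 \<le> l" "l \<le> 1"
  shows "sup_dist (tight_mdp h \<gamma>) (opt_value (tight_mdp h \<gamma>))
    (lambda_return (tight_mdp h \<gamma>) l tight_policy tight_value)
      = \<gamma> * (1 - l) / (1 - l * \<gamma>) + \<gamma> ^ h"
proof (rule antisym)
  let ?x = "lambda_return (tight_mdp h \<gamma>) l tight_policy tight_value"
  let ?k = "\<gamma> * (1 - l) / (1 - l * \<gamma>)"
  show "sup_dist (tight_mdp h \<gamma>) (opt_value (tight_mdp h \<gamma>)) ?x \<le> ?k + \<gamma> ^ h"
    using tight.lambda_return_error[OF h tight_greedy tight_consistent l] by (simp add: tight_sup_dist)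
  have pol: "tight_policy \<in> policies (tight_mdp h \<gamma>)"
    by (simp add: policies_def)
  note fp = tight.lambda_return_fixpoint[OF pol l, of _ tight_value]
  have x1: "?x 1 = \<gamma> * ((1 - l) * (- 1) + l * ?x 1)"
    using fp[of 1] by (simp add: tight_bellman[simplified])
  have "?x 0 = \<gamma> * ((1 - l) * (- 1) + l * ?x 1)"
    using fp[of 0] by (simp add: tight_bellman[simplified])
  then have "?x 0 = ?x 1"
    using x1 by simp
  moreover have "?x 1 = - ?k"
  proof -
    have "l * \<gamma> < 1"
      using mult_right_mono[of l 1 \<gamma>] l \<gamma> by linarith
    then show ?thesis
      using x1 by (simp add: field_simps)
  qed
  ultimately show "?k + \<gamma> ^ h \<le> sup_dist (tight_mdp h \<gamma>) (opt_value (tight_mdp h \<gamma>)) ?x"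
    using tight.sup_dist_ge[of 0 "opt_value (tight_mdp h \<gamma>)" ?x]
    by (simp add: tight_opt_value)
qed

text \<open>Excludes the degenerate case in which both bounds read \<open>0 = 0\<close>.\<close>

lemma tight_value_not_opt: "tight_value \<noteq> opt_value (tight_mdp h \<gamma>)"
proof
  assume "tight_value = opt_value (tight_mdp h \<gamma>)"
  from fun_cong[OF this, of 1] show False
    by (simp add: tight_opt_value)
qed

lemma finite_tight_mdp: "finite_mdp (tight_mdp h \<gamma>)"
  by (rule tight.finite_mdp)

end


text \<open>The witness is built from \<open>h\<close> and \<open>\<gamma>\<close> alone, and the
  same one attains both bounds.\<close>

theorem theorem3:
  fixes h m :: nat and l \<gamma> :: real
  assumes "h > 1" and "m \<ge> 1" and "0 \<le> l" and "l \<le> 1" and "0 < \<gamma>" and "\<gamma> < 1"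
  shows
    "(\<forall>(M :: ('s, 'a) mdp) v \<pi>.
        finite_mdp M \<and> discount M = \<gamma> \<and> v \<in> value_functions M \<and>
        \<pi> \<in> greedy_policies M h v \<and> greedy_consistent M h v \<pi> \<longrightarrow>
          sup_dist M (opt_value M) ((bellman M \<pi> ^^ m) v)
            \<le> (\<gamma> ^ m + \<gamma> ^ h) * sup_dist M (opt_value M) v \<and>
          sup_dist M (opt_value M) (lambda_return M l \<pi> v)
            \<le> (\<gamma> * (1 - l) / (1 - l * \<gamma>) + \<gamma> ^ h) * sup_dist M (opt_value M) v)
     \<and>
     (\<exists>(M :: (nat, nat) mdp) v \<pi>.
        finite_mdp M \<and> discount M = \<gamma> \<and> v \<in> value_functions M \<and>
        \<pi> \<in> greedy_policies M h v \<and> greedy_consistent M h v \<pi> \<and>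
        v \<noteq> opt_value M \<and>
          sup_dist M (opt_value M) ((bellman M \<pi> ^^ m) v)
            = (\<gamma> ^ m + \<gamma> ^ h) * sup_dist M (opt_value M) v \<and>
          sup_dist M (opt_value M) (lambda_return M l \<pi> v)
            = (\<gamma> * (1 - l) / (1 - l * \<gamma>) + \<gamma> ^ h) * sup_dist M (opt_value M) v)"
proof (intro conjI allI impI; (elim conjE)?)
  fix M :: "('s, 'a) mdp" and v \<pi>
  assume M: "finite_mdp M" "discount M = \<gamma>"
    and \<pi>: "\<pi> \<in> greedy_policies M h v" "greedy_consistent M h v \<pi>"
  interpret mdp_model M
    by unfold_locales fact
  show "sup_dist M (opt_value M) ((bellman M \<pi> ^^ m) v)
      \<le> (\<gamma> ^ m + \<gamma> ^ h) * sup_dist M (opt_value M) v"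
    using multi_step_error[OF \<open>h > 1\<close> \<pi> \<open>m \<ge> 1\<close>] M(2) by simp
  show "sup_dist M (opt_value M) (lambda_return M l \<pi> v)
      \<le> (\<gamma> * (1 - l) / (1 - l * \<gamma>) + \<gamma> ^ h) * sup_dist M (opt_value M) v"
    using lambda_return_error[OF \<open>h > 1\<close> \<pi> \<open>0 \<le> l\<close> \<open>l \<le> 1\<close>] M(2) by simp
next
  note tight = \<open>h > 1\<close> \<open>0 < \<gamma>\<close> \<open>\<gamma> < 1\<close>
  have "tight_value \<in> value_functions (tight_mdp h \<gamma>)"
    by (simp add: value_functions_def tight_value_def tight_mdp_simps[OF tight])
  then show "\<exists>(M :: (nat, nat) mdp) v \<pi>.
        finite_mdp M \<and> discount M = \<gamma> \<and> v \<in> value_functions M \<and>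
        \<pi> \<in> greedy_policies M h v \<and> greedy_consistent M h v \<pi> \<and>
        v \<noteq> opt_value M \<and>
          sup_dist M (opt_value M) ((bellman M \<pi> ^^ m) v)
            = (\<gamma> ^ m + \<gamma> ^ h) * sup_dist M (opt_value M) v \<and>
          sup_dist M (opt_value M) (lambda_return M l \<pi> v)
            = (\<gamma> * (1 - l) / (1 - l * \<gamma>) + \<gamma> ^ h) * sup_dist M (opt_value M) v"
    using finite_tight_mdp[OF tight] tight_mdp_simps[OF tight] tight_greedy[OF tight]
      tight_consistent[OF tight] tight_value_not_opt[OF tight] tight_sup_dist[OF tight]
      tight_multi_step_error[OF tight \<open>m \<ge> 1\<close>] tight_lambda_return_error[OF tight \<open>0 \<le> l\<close> \<open>l \<le> 1\<close>]
    by (intro exI[of _ "tight_mdp h \<gamma>"] exI[of _ tight_value] exI[of _ tight_policy]) simp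
qed

end
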